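(* Let $M\in\{0,1\}^{\mathbb{N}}$ be the Morse sequence. The shift system $(X_M,\sigma)$ defined by $M$ is a spacer rank-two system.
   Context: The Morse sequence is $M=\lim_{n\to\infty}\zeta^n(0)$ where $\zeta$ is the substitution $0\mapsto 01$, $1\mapsto 10$. For an infinite word $V$, $X_V=\{x\in\{0,1\}^{\mathbb{Z}}:\text{every finite subword of }x\text{ is a subword of }V\}$, with the shift $\sigma(x)(i)=x(i+1)$. Building: $\mathbb{N}$ is the set of nonnegative integers; $\mathcal{F}$ is the set of all finite binary words that start and end with $0$; $1^a$ is $a$ consecutive $1$s. For finite $S\subset\mathcal{F}$, a finite word $w$ is built from $S$ if $w=v_11^{a_1}v_21^{a_2}\cdots v_k1^{a_k}v_{k+1}$ for some $k\ge 1$, $v_i\in S$, $a_i\in\mathbb{N}$; it is built from $S$ starting with $u$ if moreover one can take $v_1=u$. An infinite word $V$ has an at most spacer rank-$n$ construction if there are finite sets $S_i=\{v_{i,1},\dots,v_{i,n_i}\}\subset\mathcal{F}$ ($i\in\mathbb{N}$) with $1\le n_i\le n$ such that: $v_{0,j}=0$ for all $j$; $v_{i+1,1}$ is built from $S_i$ starting with $v_{i,1}$; $v_{i+1,j}$ is built from $S_i$ for all $2\le j\le n_{i+1}$; and $v_{i,1}$ is an initial segment of $V$ for all $i$. A rank-one construction is an at most spacer rank-$1$ construction; $V$ has a spacer rank-two construction if it has an at most spacer rank-$2$ construction but no at most spacer rank-$1$ construction. A subshift $X$ is a spacer rank-two system if there is a word $W$ with a spacer rank-two construction such that $X=X_W$,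 and there is no word $W'$ with a rank-one construction such that $X=X_{W'}$. *)

theory Defs
  imports "HOL-Analysis.Analysis" "HOL-Library.Z2"
begin

text \<open>
  The alphabet \<open>{0, 1}\<close> is the two-element type \<^typ>\<open>bit\<close>; only its two constants are used,
  not its arithmetic. Finite words are lists, infinite words are functions on \<^typ>\<open>nat\<close> and
  bi-infinite words are functions on \<^typ>\<open>int\<close>.
\<close>

type_synonym word = "bit list"
type_synonym inf_word = "nat \<Rightarrow> bit"
type_synonym biinf_word = "int \<Rightarrow> bit"

definition subword_of_inf :: "word \<Rightarrow> inf_word \<Rightarrow> bool" where
  "subword_of_inf u V \<longleftrightarrow> (\<exists>i. \<forall>j<length u. u ! j = V (i + j))"

definition subword_of_biinf :: "word \<Rightarrow> biinf_word \<Rightarrow> bool" where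
  "subword_of_biinf u x \<longleftrightarrow> (\<exists>i. \<forall>j<length u. u ! j = x (i + int j))"

definition initial_segment :: "word \<Rightarrow> inf_word \<Rightarrow> bool" where
  "initial_segment u V \<longleftrightarrow> (\<forall>j<length u. u ! j = V j)"

definition shift :: "biinf_word \<Rightarrow> biinf_word" where
  "shift x = (\<lambda>i. x (i + 1))"

definition subshift :: "biinf_word set \<Rightarrow> bool" where
  "subshift X \<longleftrightarrow>
     closedin (product_topology (\<lambda>_. discrete_topology UNIV) UNIV) X \<and> shift ` X = X"

definition system_of :: "inf_word \<Rightarrow> biinf_word set" where
  "system_of V = {x. \<forall>u. subword_of_biinf u x \<longrightarrow> subword_of_inf u V}"

definition zero_words :: "word set" where
  "zero_words = {w. w \<noteq> [] \<and> hd w = 0 \<and> last w = 0}"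

text \<open>
  \<open>spaced_concat k v a\<close> is the word \<open>v\<^sub>1 1\<^bsup>a\<^sub>1\<^esup> v\<^sub>2 1\<^bsup>a\<^sub>2\<^esup> \<dots> v\<^sub>k 1\<^bsup>a\<^sub>k\<^esup> v\<^bsub>k+1\<^esub>\<close>.
\<close>

definition spaced_concat :: "nat \<Rightarrow> (nat \<Rightarrow> word) \<Rightarrow> (nat \<Rightarrow> nat) \<Rightarrow> word" where
  "spaced_concat k v a = concat (map (\<lambda>i. v i @ replicate (a i) 1) [1..<k + 1]) @ v (k + 1)"

definition built_from :: "word set \<Rightarrow> word \<Rightarrow> bool" where
  "built_from S w \<longleftrightarrow>
     (\<exists>k v a. 1 \<le> k \<and> (\<forall>i\<in>{1..k + 1}. v i \<in> S) \<and> w = spaced_concat k v a)"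

definition built_from_starting :: "word set \<Rightarrow> word \<Rightarrow> word \<Rightarrow> bool" where
  "built_from_starting S u w \<longleftrightarrow>
     (\<exists>k v a. 1 \<le> k \<and> (\<forall>i\<in>{1..k + 1}. v i \<in> S) \<and> v 1 = u \<and> w = spaced_concat k v a)"

text \<open>
  In the following definition \<open>N i\<close> is the number \<open>n\<^sub>i\<close> of indices at level \<open>i\<close>, and \<open>v i j\<close> matters
  only for \<open>1 \<le> j \<le> N i\<close>. The words listed at one level may repeat: at level 0 all of them are \<open>0\<close>.
\<close>

definition at_most_spacer_rank :: "nat \<Rightarrow> inf_word \<Rightarrow> bool" where
  "at_most_spacer_rank n V \<longleftrightarrow>
     (\<exists>(N :: nat \<Rightarrow> nat) (v :: nat \<Rightarrow> nat \<Rightarrow> word).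
        (\<forall>i. 1 \<le> N i \<and> N i \<le> n) \<and>
        (\<forall>i. \<forall>j\<in>{1..N i}. v i j \<in> zero_words) \<and>
        (\<forall>j\<in>{1..N 0}. v 0 j = [0]) \<and>
        (\<forall>i. built_from_starting (v i ` {1..N i}) (v i 1) (v (i + 1) 1)) \<and>
        (\<forall>i. \<forall>j\<in>{2..N (i + 1)}. built_from (v i ` {1..N i}) (v (i + 1) j)) \<and>
        (\<forall>i. initial_segment (v i 1) V))"

definition rank_one_construction :: "inf_word \<Rightarrow> bool" where
  "rank_one_construction V \<longleftrightarrow> at_most_spacer_rank 1 V"

definition spacer_rank_two_construction :: "inf_word \<Rightarrow> bool" where
  "spacer_rank_two_construction V \<longleftrightarrow> at_most_spacer_rank 2 V \<and> \<not> at_most_spacer_rank 1 V"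

definition spacer_rank_two_system :: "biinf_word set \<Rightarrow> bool" where
  "spacer_rank_two_system X \<longleftrightarrow>
     subshift X \<and>
     (\<exists>W. spacer_rank_two_construction W \<and> X = system_of W) \<and>
     \<not> (\<exists>W'. rank_one_construction W' \<and> X = system_of W')"

definition morse_letter :: "bit \<Rightarrow> word" where
  "morse_letter a = (if a = 0 then [0, 1] else [1, 0])"

definition morse_subst :: "word \<Rightarrow> word" where
  "morse_subst w = concat (map morse_letter w)"

definition converges_to :: "(nat \<Rightarrow> word) \<Rightarrow> inf_word \<Rightarrow> bool" where
  "converges_to w V \<longleftrightarrow> (\<forall>i. \<forall>\<^sub>F n in sequentially. i < length (w n) \<and> w n ! i = V i)"

definition morse :: inf_word where
  "morse = (THE V. converges_to (\<lambda>n. (morse_subst ^^ n) [0]) V)"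

text \<open>The limit defining \<^const>\<open>morse\<close> exists and is unique.\<close>

lemma converges_to_unique:
  assumes "converges_to w V" and "converges_to w V'"
  shows "V = V'"
proof
  fix i
  have "\<forall>\<^sub>F n in sequentially. V i = V' i"
    using assms[unfolded converges_to_def, rule_format, of i] by eventually_elim simp
  then show "V i = V' i" by simp
qed

lemma length_morse_power: "length ((morse_subst ^^ n) [0]) = 2 ^ n"
proof -
  have "length (morse_subst w) = 2 * length w" for w
    by (induction w) (auto simp: morse_subst_def morse_letter_def)
  then show ?thesis by (induction n) auto
qed

lemma morse_power_Suc: "\<exists>r. (morse_subst ^^ Suc n) [0] = (morse_subst ^^ n) [0] @ r"
proof (induction n)
  case 0
  then show ?case by (simp add: morse_subst_def morse_letter_def)
next
  case (Suc n)
  then obtain r where r: "(morse_subst ^^ Suc n) [0] = (morse_subst ^^ n) [0] @ r" by blast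
  have "(morse_subst ^^ Suc (Suc n)) [0] = morse_subst ((morse_subst ^^ Suc n) [0])" by simp
  also have "\<dots> = (morse_subst ^^ Suc n) [0] @ morse_subst r"
    by (subst r, subst funpow.simps(2)) (simp add: morse_subst_def)
  finally show ?case by blast
qed

lemma converges_to_morse: "converges_to (\<lambda>n. (morse_subst ^^ n) [0]) morse"
proof -
  let ?w = "\<lambda>n. (morse_subst ^^ n) [0]"
  have stable: "?w n ! i = ?w i ! i" if "i \<le> n" for i n
    using that
  proof (induction n rule: dec_induct)
    case (step m)
    obtain r where r: "?w (Suc m) = ?w m @ r" using morse_power_Suc by blast
    have "i < 2 ^ m" using step.hyps less_exp[of m] by linarith
    then have "i < length (?w m)" by (simp add: length_morse_power)
    then show ?case unfolding r using step.IH by (simp add: nth_append)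
  qed simp
  have "converges_to ?w (\<lambda>i. ?w i ! i)"
    unfolding converges_to_def
  proof
    fix i
    show "\<forall>\<^sub>F n in sequentially. i < length (?w n) \<and> ?w n ! i = ?w i ! i"
    proof (rule eventually_sequentiallyI[of i])
      fix n assume "i \<le> n"
      then have "i < 2 ^ n" using less_exp[of n] by linarith
      with stable[OF \<open>i \<le> n\<close>] show "i < length (?w n) \<and> ?w n ! i = ?w i ! i"
        by (simp add: length_morse_power)
    qed
  qed
  then have "\<exists>!V. converges_to ?w V" using converges_to_unique by blast
  then show ?thesis unfolding morse_def by (rule theI')
qed

end

theory Submission
  imports Defs
begin

text \<open>
  With \<open>A\<^sub>n = \<zeta>\<^bsup>2n\<^esup>(0)\<close> and \<open>\<zeta>\<^bsup>2n\<^esup>(1) = 1 C\<^sub>n 1\<close> one has, for \<open>n \<ge> 1\<close>,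
  \<open>A\<^bsub>n+1\<^esub> = A\<^sub>n 1 C\<^sub>n 11 C\<^sub>n 1 A\<^sub>n\<close> and \<open>C\<^bsub>n+1\<^esub> = C\<^sub>n 1 A\<^sub>n A\<^sub>n 1 C\<^sub>n\<close>, so the Morse
  sequence itself has an at most spacer rank-2 construction.

  If a rank-one word defined the same subshift, every factor of the Morse sequence would be cut
  into copies of one long word \<open>v\<close> separated by spacers \<open>1\<^sup>a\<close>, where \<open>a \<le> 2\<close> because \<open>111\<close> is not
  a factor. The positions of a long word in the Morse sequence agree modulo 4, so all these spacers
  have the same length. Hence the Morse sequence contains high powers, which it does not.
\<close>

section \<open>The Morse sequence\<close>

lemma morse_subst_append: "morse_subst (x @ y) = morse_subst x @ morse_subst y"
  by (simp add: morse_subst_def)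

lemma morse_subst_power_append:
  "(morse_subst ^^ n) (x @ y) = (morse_subst ^^ n) x @ (morse_subst ^^ n) y"
  by (induction n) (simp_all add: morse_subst_append)

lemma morse_subst_nth:
  assumes "i < length w"
  shows "morse_subst w ! (2 * i) = w ! i" and "morse_subst w ! (2 * i + 1) = w ! i + 1"
  using assms
proof (induction w arbitrary: i)
  case (Cons a w)
  {
    case 1
    then show ?case
      using Cons.IH(1)[of "i - 1"] by (cases i) (auto simp: morse_subst_def morse_letter_def)
  next
    case 2
    then show ?case
      using Cons.IH(2)[of "i - 1"] by (cases i) (auto simp: morse_subst_def morse_letter_def)
  }
qed auto

lemma morse_power_nth:
  assumes "i < 2 ^ n"
  shows "(morse_subst ^^ n) [0] ! i = morse i"
proof -
  have prefix: "\<exists>r. (morse_subst ^^ m) [0] = (morse_subst ^^ n) [0] @ r" if "n \<le> m" for m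
    using that
  proof (induction m rule: dec_induct)
    case (step m)
    then show ?case using morse_power_Suc[of m] by (metis append.assoc)
  qed simp
  have "\<forall>\<^sub>F m in sequentially. n \<le> m \<and> (morse_subst ^^ m) [0] ! i = morse i"
    using converges_to_morse[unfolded converges_to_def, rule_format, of i] eventually_ge_at_top[of n]
    by eventually_elim simp
  then obtain m where "n \<le> m" "(morse_subst ^^ m) [0] ! i = morse i"
    using eventually_happens'[OF sequentially_bot] by blast
  moreover obtain r where "(morse_subst ^^ m) [0] = (morse_subst ^^ n) [0] @ r"
    using prefix[OF \<open>n \<le> m\<close>] by blast
  ultimately show ?thesis
    using assms by (simp add: nth_append length_morse_power)
qed

text \<open>Letter i of zeta^i(0), which exists because i < 2^i, expands to letters 2i and 2i+1 of
  zeta^(i+1)(0). In \<open>bit\<close>, adding 1 is complementation.\<close>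

lemma morse_double: "morse (2 * i) = morse i"
  and morse_double_Suc: "morse (Suc (2 * i)) = morse i + 1"
proof -
  have i: "i < 2 ^ i" by (rule less_exp)
  then have len: "i < length ((morse_subst ^^ i) [0])" by (simp add: length_morse_power)
  show "morse (2 * i) = morse i"
    using morse_power_nth[of "2 * i" "Suc i"] morse_subst_nth(1)[OF len] morse_power_nth[OF i] i
    by simp
  show "morse (Suc (2 * i)) = morse i + 1"
    using morse_power_nth[of "Suc (2 * i)" "Suc i"] morse_subst_nth(2)[OF len] morse_power_nth[OF i] i
    by simp
qed

lemma morse_0: "morse 0 = 0"
  using morse_power_nth[of 0 0] by simp

text \<open>\<open>morse\<close> is the parity of the binary digit sum, and \<open>2 ^ m * t\<close>
  and \<open>r\<close> occupy disjoint digits. The induction strips the lowest digit.\<close>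

lemma morse_mult_power_add:
  "r < 2 ^ m \<Longrightarrow> morse (2 ^ m * t + r) = morse t + morse r"
proof (induction m arbitrary: r)
  case (Suc m)
  define s where "s = r div 2"
  have s: "s < 2 ^ m" using Suc.prems by (auto simp: s_def)
  consider "r = 2 * s" | "r = Suc (2 * s)" unfolding s_def by linarith
  then show ?case
  proof cases
    case 1
    then have "2 ^ Suc m * t + r = 2 * (2 ^ m * t + s)" by simp
    then show ?thesis using Suc.IH[OF s] 1 by (simp only: morse_double)
  next
    case 2
    then have "2 ^ Suc m * t + r = Suc (2 * (2 ^ m * t + s))" by simp
    then show ?thesis using Suc.IH[OF s] 2 by (simp only: morse_double_Suc add.assoc)
  qed
qed (simp add: morse_0)

text \<open>Complementing m binary digits turns a digit sum s into m - s. For even m this makes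
  zeta^m(0) a palindrome.\<close>

lemma morse_reflect:
  "r < 2 ^ m \<Longrightarrow> morse (2 ^ m - 1 - r) = morse r + of_nat m"
proof (induction m arbitrary: r)
  case 0
  then have "r = 0" by simp
  then show ?case by simp
next
  case (Suc m)
  define s where "s = r div 2"
  have s: "s < 2 ^ m" using Suc.prems by (auto simp: s_def)
  consider "r = 2 * s" | "r = Suc (2 * s)" unfolding s_def by linarith
  then show ?case
  proof cases
    case 1
    then have "2 ^ Suc m - 1 - r = Suc (2 * (2 ^ m - 1 - s))" using s by simp
    then have "morse (2 ^ Suc m - 1 - r) = morse (2 ^ m - 1 - s) + 1"
      by (simp only: morse_double_Suc)
    also have "\<dots> = morse r + of_nat (Suc m)"
      unfolding Suc.IH[OF s] 1 morse_double by (simp only: of_nat_Suc ac_simps)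
    finally show ?thesis .
  next
    case 2
    then have "2 ^ Suc m - 1 - r = 2 * (2 ^ m - 1 - s)" using s by simp
    then have "morse (2 ^ Suc m - 1 - r) = morse (2 ^ m - 1 - s)"
      by (simp only: morse_double)
    \<comment> \<open>\<open>1 + 1\<close> is 0 in \<open>bit\<close>: one summand turns
      \<open>morse s\<close> into \<open>morse r\<close>, the other completes
      \<open>of_nat (Suc m)\<close>.\<close>
    also have "\<dots> = morse s + (1 + 1) + of_nat m"
      using Suc.IH[OF s] by simp
    also have "\<dots> = morse r + of_nat (Suc m)"
      unfolding 2 morse_double_Suc by (simp only: of_nat_Suc ac_simps)
    finally show ?thesis .
  qed
qed

section \<open>Repetitions and recognizability\<close>

lemma morse_even_neq:
  assumes "even i"
  shows "morse i \<noteq> morse (Suc i)"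
proof -
  obtain j where "i = 2 * j" using assms by (elim evenE)
  then show ?thesis by (cases "morse j") (simp_all add: morse_double morse_double_Suc)
qed

lemma morse_odd_neq_iff: "morse (Suc (2 * r)) \<noteq> morse (Suc (Suc (2 * r))) \<longleftrightarrow> morse r = morse (Suc r)"
  using morse_double[of "Suc r"] by (cases "morse r"; cases "morse (Suc r)") (auto simp: morse_double_Suc)

lemma morse_no_three: "\<not> (morse i = morse (Suc i) \<and> morse (Suc i) = morse (Suc (Suc i)))"
  using morse_even_neq[of i] morse_even_neq[of "Suc i"] by (cases "even i") auto

text \<open>Pairs at even positions are images of letters and have distinct entries. An odd shift
  carries them to pairs straddling two images, whose entries differ only above equal neighbours. Two
  consecutive such pairs force three equal letters in a row.\<close>

lemma morse_no_odd_shift: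
  assumes "odd n" and eq: "\<And>u. u < 4 \<Longrightarrow> morse (2 * b + u) = morse (2 * b + u + n)"
  shows False
proof -
  obtain c where n: "n = Suc (2 * c)" using \<open>odd n\<close> by (elim oddE) simp
  have "morse (b + c + i) = morse (Suc (b + c + i))" if "i < 2" for i
  proof -
    have "morse (2 * (b + i)) \<noteq> morse (Suc (2 * (b + i)))" by (rule morse_even_neq) simp
    moreover have "morse (2 * (b + i)) = morse (Suc (2 * (b + c + i)))"
      using eq[of "2 * i"] that by (simp add: n algebra_simps)
    moreover have "morse (Suc (2 * (b + i))) = morse (Suc (Suc (2 * (b + c + i))))"
      using eq[of "Suc (2 * i)"] that by (simp add: n algebra_simps)
    ultimately show ?thesis using morse_odd_neq_iff[of "b + c + i"] by metis
  qed
  from this[of 0] this[of 1] have "morse (b + c) = morse (Suc (b + c))"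
      "morse (Suc (b + c)) = morse (Suc (Suc (b + c)))"
    by simp_all
  then show False using morse_no_three by blast
qed

text \<open>An even period is halved along \<^term>\<open>morse (2 * i) = morse i\<close> until it becomes odd.\<close>

lemma morse_no_fifth_power:
  assumes "0 < n" "\<And>u. b \<le> u \<Longrightarrow> u < b + 5 * n \<Longrightarrow> morse u = morse (u + n)"
  shows False
  using assms
proof (induction n arbitrary: b rule: less_induct)
  case (less n)
  show False
  proof (cases "even n")
    case True
    then obtain c where n: "n = 2 * c" by (elim evenE)
    show False
    proof (rule less.IH[of c "(b + 1) div 2"])
      fix u assume "(b + 1) div 2 \<le> u" "u < (b + 1) div 2 + 5 * c"
      then have "b \<le> 2 * u" "2 * u < b + 5 * n" unfolding n by linarith+
      then have "morse (2 * u) = morse (2 * (u + c))"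
        using less.prems(2)[of "2 * u"] by (simp add: n)
      then show "morse u = morse (u + c)" by (simp only: morse_double)
    qed (use less.prems(1) n in auto)
  next
    case False
    show False
    \<comment> \<open>Four letters from the first even position at or after \<open>b\<close> lie
      within five positions, and \<open>5 * n\<close> is at least 5.\<close>
    proof (rule morse_no_odd_shift[OF False, of "(b + 1) div 2"])
      fix u :: nat assume "u < 4"
      then show "morse (2 * ((b + 1) div 2) + u) = morse (2 * ((b + 1) div 2) + u + n)"
        using less.prems by (intro less.prems(2)) linarith+
    qed
  qed
qed

text \<open>Five letters always contain four that start at an even position, so an odd distance
  contradicts \<open>morse_no_odd_shift\<close>.\<close>

lemma morse_recognizable_mod_2:
  assumes eq: "\<And>j. j < 5 \<Longrightarrow> morse (s + j) = morse (t + j)"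
  shows "s mod 2 = t mod 2"
proof -
  have False if st: "s \<le> t" "odd (t - s)" and eq: "\<And>j. j < 5 \<Longrightarrow> morse (s + j) = morse (t + j)"
    for s t
  proof (rule morse_no_odd_shift[OF st(2), of "(s + 1) div 2"])
    fix u :: nat assume "u < 4"
    then show "morse (2 * ((s + 1) div 2) + u) = morse (2 * ((s + 1) div 2) + u + (t - s))"
      using eq[of "2 * ((s + 1) div 2) - s + u"] st(1) by (auto simp: ac_simps)
  qed
  then have even: "even (t - s)"
    if "s \<le> t" "\<And>j. j < 5 \<Longrightarrow> morse (s + j) = morse (t + j)" for s t
    using that by blast
  show ?thesis
  proof (cases "s \<le> t")
    case True
    then have "even (t - s)" using even[of s t] eq by simp
    then show ?thesis using True by presburger
  next
    case False
    have "even (s - t)" using even[of t s] eq False by simp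
    then show ?thesis using False by presburger
  qed
qed

text \<open>Once the parities agree, the even positions among the ten recover five letters of the
  preimage, starting at \<open>c\<close> and \<open>d\<close>, whose parities then agree as
  well.\<close>

lemma morse_recognizable_mod_4:
  assumes eq: "\<And>j. j < 10 \<Longrightarrow> morse (s + j) = morse (t + j)"
  shows "s mod 4 = t mod 4"
proof -
  have parity: "s mod 2 = t mod 2"
    using eq by (intro morse_recognizable_mod_2) simp
  define c d where "c = (s + 1) div 2" and "d = (t + 1) div 2"
  have "c mod 2 = d mod 2"
  proof (rule morse_recognizable_mod_2)
    fix j :: nat assume "j < 5"
    moreover have "2 * (c + j) = s + (2 * j + s mod 2)" "2 * (d + j) = t + (2 * j + s mod 2)"
      using parity unfolding c_def d_def by presburger+
    moreover have "2 * j + s mod 2 < 10" using \<open>j < 5\<close> by linarith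
    ultimately have "morse (2 * (c + j)) = morse (2 * (d + j))"
      using eq by metis
    then show "morse (c + j) = morse (d + j)" by (simp only: morse_double)
  qed
  then have "(2 * c) mod 4 = (2 * d) mod 4"
    using mult_mod_right[of 2 c 2] mult_mod_right[of 2 d 2] by simp
  moreover have "2 * c = s + s mod 2" "2 * d = t + s mod 2"
    using parity unfolding c_def d_def by presburger+
  moreover have "s mod 2 = 0 \<or> s mod 2 = 1" by presburger
  ultimately have "s mod 4 = t mod 4 \<or> Suc s mod 4 = Suc t mod 4" by auto
  then show ?thesis by (auto simp: mod_Suc split: if_splits)
qed

section \<open>The subshift\<close>

lemma subshift_system_of: "subshift (system_of V)"
  unfolding subshift_def
proof
  let ?T = "product_topology (\<lambda>_::int. discrete_topology (UNIV :: bit set)) UNIV"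
  \<comment> \<open>\<open>D u i\<close> consists of the points in which \<open>u\<close> does not
    occur at \<open>i\<close>, a finite union of closed sets. Intersecting over all non-factors
    \<open>u\<close> and all \<open>i\<close> gives the system.\<close>
  define D where "D u i = {x. \<exists>j<length u. u ! j \<noteq> x (i + int j)}" for u :: word and i
  have "closedin ?T {x \<in> topspace ?T. x k \<in> - {a}}" for k a
    by (rule closedin_continuous_map_preimage[OF continuous_map_product_projection]) auto
  then have "closedin ?T (\<Union>j<length u. {x \<in> topspace ?T. x (i + int j) \<in> - {u ! j}})" for u i
    by (intro closedin_Union finite_imageI) auto
  moreover have "(\<Union>j<length u. {x \<in> topspace ?T. x (i + int j) \<in> - {u ! j}}) = D u i" for u i
    by (auto simp: D_def)
  ultimately have "closedin ?T (D u i)" for u i by simp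
  \<comment> \<open>The whole space keeps the family nonempty when every word is a factor of
    \<open>V\<close>.\<close>
  then have "closedin ?T (\<Inter> (insert (topspace ?T) {D u i |u i. \<not> subword_of_inf u V}))"
    using closedin_topspace[of ?T] by (intro closedin_Inter) auto
  moreover have "x \<in> system_of V \<longleftrightarrow> (\<forall>u i. \<not> subword_of_inf u V \<longrightarrow> x \<in> D u i)" for x
    unfolding system_of_def subword_of_biinf_def D_def mem_Collect_eq by meson
  then have "\<Inter> (insert (topspace ?T) {D u i |u i. \<not> subword_of_inf u V}) = system_of V"
    by auto
  ultimately show "closedin ?T (system_of V)" by simp
next
  have shifted: "(\<lambda>i. x (i + k)) \<in> system_of V" if "x \<in> system_of V" for x k
    unfolding system_of_def
  proof (intro CollectI allI impI)
    fix u assume "subword_of_biinf u (\<lambda>i. x (i + k))"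
    then obtain i where "\<forall>j<length u. u ! j = x (i + int j + k)" by (auto simp: subword_of_biinf_def)
    then have "subword_of_biinf u x"
      unfolding subword_of_biinf_def by (intro exI[of _ "i + k"]) (simp add: ac_simps)
    then show "subword_of_inf u V" using that by (simp add: system_of_def)
  qed
  show "shift ` system_of V = system_of V"
  proof
    show "shift ` system_of V \<subseteq> system_of V" using shifted[of _ 1] by (auto simp: shift_def)
    show "system_of V \<subseteq> shift ` system_of V"
    proof
      fix x assume "x \<in> system_of V"
      moreover have "x = shift (\<lambda>i. x (i + (- 1)))" by (simp add: shift_def)
      ultimately show "x \<in> shift ` system_of V" using shifted[of x "- 1"] by blast
    qed
  qed
qed

text \<open>
  Every central block of the two-sided word (reversed Morse).(Morse) lies in some \<open>\<zeta>\<^bsup>2n\<^esup>(00)\<close>,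
  because \<open>\<zeta>\<^bsup>2n\<^esup>(0)\<close> is a palindrome; and \<open>00\<close> occurs in the Morse sequence at position 5.
\<close>

lemma morse_reflected_in_system:
  "(\<lambda>i. if 0 \<le> i then morse (nat i) else morse (nat (- 1 - i))) \<in> system_of morse"
  (is "?x \<in> _")
  unfolding system_of_def
proof (intro CollectI allI impI)
  fix u assume "subword_of_biinf u ?x"
  then obtain i where i: "\<And>j. j < length u \<Longrightarrow> u ! j = ?x (i + int j)"
    by (auto simp: subword_of_biinf_def)
  define n where "n = nat \<bar>i\<bar> + length u"
  \<comment> \<open>The exponent is even so that reflection does not complement letters.\<close>
  define N :: nat where "N = 2 ^ (2 * n)"
  have N: "n < N" unfolding N_def using less_exp[of n] by (metis le_less_trans less_exp mult_2 le_add1)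
  have m5: "morse 5 = 0" "morse 6 = 0"
    using morse_double_Suc[of 2] morse_double[of 1] morse_double[of 3] morse_double_Suc[of 1]
      morse_double_Suc[of 0] morse_0 by simp_all
  \<comment> \<open>The blocks of length \<open>N\<close> numbered 5 and 6 are both zeta^(2n)(0), so
    their boundary \<open>6 * N\<close> serves as the origin.\<close>
  have x: "?x k = morse (nat (6 * int N + k))" if "- int N \<le> k" "k < int N" for k
  proof (cases "0 \<le> k")
    case True
    then show ?thesis
      using morse_mult_power_add[of "nat k" "2 * n" 6] that m5
      by (simp add: N_def nat_add_distrib nat_mult_distrib nat_power_eq mult.commute)
  next
    case False
    define r where "r = nat (- 1 - k)"
    have r: "r < N" "k = - 1 - int r" using False that by (auto simp: r_def)
    have "nat (6 * int N + k) = N * 5 + (N - 1 - r)" using r by linarith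
    moreover have "morse (N - 1 - r) = morse r"
      using morse_reflect[of r "2 * n"] r(1) by (simp add: N_def)
    moreover have "morse (N * 5 + (N - 1 - r)) = morse 5 + morse (N - 1 - r)"
      unfolding N_def by (rule morse_mult_power_add) simp
    ultimately show ?thesis using False m5 by (simp add: r_def)
  qed
  have "u ! j = morse (nat (6 * int N + i) + j)" if "j < length u" for j
  proof -
    have "- int N \<le> i + int j" "i + int j < int N" using that N by (auto simp: n_def)
    moreover have "nat (6 * int N + (i + int j)) = nat (6 * int N + i) + j"
      using N by (auto simp: n_def)
    ultimately show ?thesis using i[OF that] x[of "i + int j"] by simp
  qed
  then show "subword_of_inf u morse" unfolding subword_of_inf_def by blast
qed

section \<open>A rank-two construction\<close>

lemma spaced_concat_cong:
  assumes "\<And>i. i \<in> {1..k + 1} \<Longrightarrow> v i = v' i" "\<And>i. i \<in> {1..k} \<Longrightarrow> a i = a' i"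
  shows "spaced_concat k v a = spaced_concat k v' a'"
proof -
  have map_eq: "map (\<lambda>i. v i @ replicate (a i) 1) [1..<k + 1] = map (\<lambda>i. v' i @ replicate (a' i) 1) [1..<k + 1]"
    by (rule map_cong) (use assms in auto)
  have "v (k + 1) = v' (k + 1)" using assms(1) by simp
  with map_eq show ?thesis by (simp only: spaced_concat_def)
qed

lemma spaced_concat_Suc:
  "spaced_concat (Suc k) v a = spaced_concat k v a @ replicate (a (Suc k)) 1 @ v (k + 2)"
  by (simp add: spaced_concat_def)

lemma built_from_starting_base:
  assumes "u \<in> S" "x \<in> S"
  shows "built_from_starting S u (u @ replicate b 1 @ x)"
  unfolding built_from_starting_def
  by (intro exI[of _ 1] exI[of _ "\<lambda>i. if i = 1 then u else x"] exI[of _ "\<lambda>_. b"])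
    (use assms in \<open>auto simp: spaced_concat_def\<close>)

lemma built_from_starting_step:
  assumes "built_from_starting S u w" "x \<in> S"
  shows "built_from_starting S u (w @ replicate b 1 @ x)"
proof -
  obtain k v a where *: "1 \<le> k" "\<forall>i\<in>{1..k + 1}. v i \<in> S" "v 1 = u" "w = spaced_concat k v a"
    using assms(1) by (auto simp: built_from_starting_def)
  let ?v = "v(k + 2 := x)" and ?a = "a(k + 1 := b)"
  \<comment> \<open>The updates lie just beyond the indices that \<open>w\<close> reads.\<close>
  have "spaced_concat k ?v ?a = w" unfolding *(4) by (rule spaced_concat_cong) auto
  then have "w @ replicate b 1 @ x = spaced_concat (Suc k) ?v ?a"
    by (simp add: spaced_concat_Suc)
  then show ?thesis
    unfolding built_from_starting_def
    by (intro exI[of _ "Suc k"] exI[of _ ?v] exI[of _ ?a]) (use * assms(2) in auto)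
qed

lemma built_from_starting_imp: "built_from_starting S u w \<Longrightarrow> built_from S w"
  unfolding built_from_starting_def built_from_def by blast

text \<open>Only even powers occur because zeta^n(0) ends in 0 exactly when n is even.\<close>

definition morse_block :: "nat \<Rightarrow> word" where
  "morse_block i = (morse_subst ^^ (2 * i)) [0]"

text \<open>For \<open>i \<ge> 1\<close> this is \<open>\<zeta>\<^bsup>2i\<^esup>(1)\<close> without its first and last letter, which are \<open>1\<close>.\<close>

fun morse_core :: "nat \<Rightarrow> word" where
  "morse_core 0 = [0]"
| "morse_core (Suc 0) = [0, 0]"
| "morse_core (Suc (Suc i)) =
     morse_core (Suc i) @ [1] @ morse_block (Suc i) @ morse_block (Suc i) @ [1] @ morse_core (Suc i)"

lemma morse_subst_power_double_Suc:
  "(morse_subst ^^ (2 * Suc i)) [0] = (morse_subst ^^ (2 * i)) [0] @ (morse_subst ^^ (2 * i)) [1] @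
     (morse_subst ^^ (2 * i)) [1] @ (morse_subst ^^ (2 * i)) [0]" (is ?A)
  "(morse_subst ^^ (2 * Suc i)) [1] = (morse_subst ^^ (2 * i)) [1] @ (morse_subst ^^ (2 * i)) [0] @
     (morse_subst ^^ (2 * i)) [0] @ (morse_subst ^^ (2 * i)) [1]" (is ?B)
proof -
  have "(morse_subst ^^ (2 * Suc i)) [a] = (morse_subst ^^ (2 * i)) (morse_subst (morse_subst [a]))" for a
    using funpow_add[of "2 * i" 2 morse_subst] by (simp add: numeral_2_eq_2)
  moreover have "morse_subst (morse_subst [0]) = [0] @ [1] @ [1] @ [0]"
      "morse_subst (morse_subst [1]) = [1] @ [0] @ [0] @ [1]"
    by (simp_all add: morse_subst_def morse_letter_def)
  ultimately show ?A ?B by (simp_all only: morse_subst_power_append)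
qed

lemma morse_core: "(morse_subst ^^ (2 * Suc i)) [1] = [1] @ morse_core (Suc i) @ [1]"
proof (induction i)
  case 0
  show ?case by (simp add: numeral_2_eq_2 morse_subst_def morse_letter_def)
next
  case (Suc i)
  show ?case
    unfolding morse_subst_power_double_Suc(2)[of "Suc i"] Suc
    by (simp add: morse_block_def)
qed

text \<open>The outer ones of zeta^(2n)(1) become spacers, and where two such images meet they form
  \<open>[1, 1]\<close>.\<close>

lemma morse_block_Suc_Suc:
  "morse_block (Suc (Suc i)) = morse_block (Suc i) @ [1] @ morse_core (Suc i) @ [1, 1] @
     morse_core (Suc i) @ [1] @ morse_block (Suc i)"
  using morse_subst_power_double_Suc(1)[of "Suc i"] morse_core[of i] by (simp add: morse_block_def)

lemma morse_block_zero_words: "morse_block i \<in> zero_words"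
proof (induction i)
  case (Suc i)
  then show ?case
    using morse_subst_power_double_Suc(1)[of i] by (auto simp: zero_words_def morse_block_def)
qed (simp add: zero_words_def morse_block_def)

lemma morse_core_zero_words: "morse_core i \<in> zero_words"
  by (induction i rule: morse_core.induct) (auto simp: zero_words_def)

lemma morse_block_built:
  "built_from_starting {morse_block i, morse_core i} (morse_block i) (morse_block (Suc i))"
proof (cases i)
  case 0
  then show ?thesis
    \<comment> \<open>At level 0 both words are 0, and zeta^2(0) = 0110 is 0 followed by two spacers
      and 0.\<close>
    using built_from_starting_base[of "[0]" "{[0]}" "[0]" 2]
    by (simp add: morse_block_def numeral_2_eq_2 morse_subst_def morse_letter_def)
next
  case (Suc m)
  let ?S = "{morse_block i, morse_core i}"
  have "built_from_starting ?S (morse_block i)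
      (((morse_block i @ replicate 1 1 @ morse_core i) @ replicate 2 1 @ morse_core i)
        @ replicate 1 1 @ morse_block i)"
    by (intro built_from_starting_step built_from_starting_base) auto
  then show ?thesis using morse_block_Suc_Suc[of m] by (simp add: Suc numeral_2_eq_2)
qed

lemma morse_core_built: "built_from {morse_block i, morse_core i} (morse_core (Suc i))"
proof (cases i)
  case 0
  then show ?thesis
    using built_from_starting_base[of "[0]" "{[0]}" "[0]" 0]
    by (intro built_from_starting_imp[of _ "[0]"]) (simp add: morse_block_def)
next
  case (Suc m)
  let ?S = "{morse_block i, morse_core i}"
  have "built_from_starting ?S (morse_core i)
      (((morse_core i @ replicate 1 1 @ morse_block i) @ replicate 0 1 @ morse_block i)
        @ replicate 1 1 @ morse_core i)"
    by (intro built_from_starting_step built_from_starting_base) auto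
  then show ?thesis by (intro built_from_starting_imp[of _ "morse_core i"]) (simp add: Suc)
qed

lemma at_most_spacer_rank_2_morse: "at_most_spacer_rank 2 morse"
  unfolding at_most_spacer_rank_def
proof (intro exI conjI)
  let ?N = "\<lambda>_::nat. 2::nat" and ?v = "\<lambda>i j. if j = (1::nat) then morse_block i else morse_core i"
  have S: "?v i ` {1..?N i} = {morse_block i, morse_core i}" for i
  proof -
    have "{1..2::nat} = {1, 2}" by auto
    then show ?thesis by auto
  qed
  show "\<forall>i. 1 \<le> ?N i \<and> ?N i \<le> 2" by simp
  show "\<forall>i. \<forall>j\<in>{1..?N i}. ?v i j \<in> zero_words"
    by (simp add: morse_block_zero_words morse_core_zero_words)
  show "\<forall>j\<in>{1..?N 0}. ?v 0 j = [0]" by (simp add: morse_block_def)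
  show "\<forall>i. built_from_starting (?v i ` {1..?N i}) (?v i 1) (?v (i + 1) 1)"
    unfolding S using morse_block_built by simp
  show "\<forall>i. \<forall>j\<in>{2..?N (i + 1)}. built_from (?v i ` {1..?N i}) (?v (i + 1) j)"
    unfolding S using morse_core_built by simp
  show "\<forall>i. initial_segment (?v i 1) morse"
    by (auto simp: initial_segment_def morse_block_def length_morse_power morse_power_nth)
qed

section \<open>No rank-one construction\<close>

text \<open>The copies of \<open>v\<close> in \<open>w\<close> start at \<open>p 0, \<dots>, p k\<close>; spacers of ones fill the rest of \<open>w\<close>.\<close>

definition parsed :: "word \<Rightarrow> word \<Rightarrow> nat \<Rightarrow> (nat \<Rightarrow> nat) \<Rightarrow> bool" where
  "parsed v w k p \<longleftrightarrow>
     p 0 = 0 \<and> length w = p k + length v \<and>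
     (\<forall>i\<le>k. \<forall>j<length v. w ! (p i + j) = v ! j) \<and>
     (\<forall>i<k. p i + length v \<le> p (Suc i) \<and> (\<forall>j. p i + length v \<le> j \<longrightarrow> j < p (Suc i) \<longrightarrow> w ! j = 1))"

text \<open>Unlike \<open>built_from\<close>, this allows a single copy of \<open>v\<close>, so that
  the levels of a rank-one construction compose.\<close>

inductive_set spaced_powers :: "word \<Rightarrow> word set" for v where
  single: "v \<in> spaced_powers v"
| snoc: "w \<in> spaced_powers v \<Longrightarrow> w @ replicate a 1 @ v \<in> spaced_powers v"

lemma spaced_powers_append:
  assumes "y \<in> spaced_powers v" "x \<in> spaced_powers v"
  shows "x @ replicate a 1 @ y \<in> spaced_powers v"
  using assms
proof (induction y)
  case (snoc w b)
  then show ?case using spaced_powers.snoc[of "x @ replicate a 1 @ w" v b] by simp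
qed (rule spaced_powers.snoc)

lemma spaced_concat_in_spaced_powers:
  assumes "\<And>i. i \<in> {1..k + 1} \<Longrightarrow> u i \<in> spaced_powers v"
  shows "spaced_concat k u a \<in> spaced_powers v"
  using assms
proof (induction k)
  case (Suc k)
  then show ?case unfolding spaced_concat_Suc by (intro spaced_powers_append) auto
qed (simp add: spaced_concat_def)

lemma spaced_powers_parsed:
  assumes "w \<in> spaced_powers v"
  obtains k p where "parsed v w k p"
proof -
  have "\<exists>k p. parsed v w k p"
    using assms
  proof induction
    case single
    show ?case by (intro exI[of _ 0] exI[of _ "\<lambda>_. 0"]) (simp add: parsed_def)
  next
    case (snoc w a)
    then obtain k p where p: "parsed v w k p" by blast
    let ?p = "p(Suc k := length w + a)"
    \<comment> \<open>This keeps the old copies and gaps inside \<open>w\<close>, the left part of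
      the new word.\<close>
    have mono: "p i \<le> p k" if "i \<le> k" for i
      using that
    proof (induction rule: inc_induct)
      case (step n)
      then show ?case using p by (force simp: parsed_def)
    qed simp
    have "parsed v (w @ replicate a 1 @ v) (Suc k) ?p"
      unfolding parsed_def
    proof (intro conjI allI impI)
      show "?p 0 = 0" "length (w @ replicate a 1 @ v) = ?p (Suc k) + length v"
        using p by (auto simp: parsed_def)
    next
      fix i j assume "i \<le> Suc k" "j < length v"
      then show "(w @ replicate a 1 @ v) ! (?p i + j) = v ! j"
        using p mono[of i] by (cases "i = Suc k") (auto simp: parsed_def nth_append)
    next
      fix i assume "i < Suc k"
      then show "?p i + length v \<le> ?p (Suc i)"
        using p by (cases "i = k") (auto simp: parsed_def)
    next
      fix i j assume *: "i < Suc k" "?p i + length v \<le> j" "j < ?p (Suc i)"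
      show "(w @ replicate a 1 @ v) ! j = 1"
      proof (cases "i = k")
        case True
        then show ?thesis using p * by (auto simp: parsed_def nth_append)
      next
        case False
        then have "i < k" using * by simp
        moreover have "p (Suc i) \<le> length w" using p mono[of "Suc i"] \<open>i < k\<close> by (simp add: parsed_def)
        ultimately have "w ! j = 1" "j < length w" using p * by (auto simp: parsed_def)
        then show ?thesis by (simp add: nth_append)
      qed
    qed
    then show ?case by blast
  qed
  then show thesis using that by blast
qed

text \<open>The window contains seven successive copies of \<open>v\<close>. Their starts agree
  modulo 4 and the spacers have length at most 2, so the distances coincide and the Morse sequence
  repeats with one period for too long.\<close>

lemma morse_window_not_spaced_power:
  assumes v: "10 \<le> length v" and w: "w \<in> spaced_powers v"
    and L: "10 * (length v + 2) \<le> L" "q + L \<le> length w"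
    and window: "\<And>t. t < L \<Longrightarrow> w ! (q + t) = morse t"
  shows False
proof -
  define l where "l = length v"
  obtain k p where p: "parsed v w k p" using spaced_powers_parsed[OF w] .
  have p0: "p 0 = 0" and len: "length w = p k + l"
    and copy: "\<And>i j. i \<le> k \<Longrightarrow> j < l \<Longrightarrow> w ! (p i + j) = v ! j"
    and gap: "\<And>i. i < k \<Longrightarrow> p i + l \<le> p (Suc i)"
    and ones: "\<And>i j. i < k \<Longrightarrow> p i + l \<le> j \<Longrightarrow> j < p (Suc i) \<Longrightarrow> w ! j = 1"
    using p unfolding parsed_def l_def by blast+
  have L': "10 * (l + 2) \<le> L" using L(1) by (simp add: l_def)
  have no_ones: False if "t + 2 < L" "\<And>j. q + t \<le> j \<Longrightarrow> j < q + t + 3 \<Longrightarrow> w ! j = 1" for t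
    using morse_no_three[of t] window[of t] window[of "Suc t"] window[of "Suc (Suc t)"]
      that(2)[of "q + t"] that(2)[of "q + t + 1"] that(2)[of "q + t + 2"] that(1) by simp
  define i0 where "i0 = (LEAST i. q \<le> p i)"
  have "q \<le> p k" using len L(2) L' by simp
  then have i0: "q \<le> p i0" "i0 \<le> k" unfolding i0_def by (auto intro: LeastI Least_le)
  \<comment> \<open>The preceding copy starts before \<open>q\<close> and ends before
    \<open>q + l\<close>; a later start of copy \<open>i0\<close> would leave 111 at
    \<open>q + l\<close>.\<close>
  have start: "p i0 \<le> q + l + 2"
  proof (cases i0)
    case 0
    then show ?thesis using p0 by simp
  next
    case (Suc i)
    then have "p i < q" unfolding i0_def by (metis lessI not_le not_less_Least)
    show ?thesis
    proof (rule ccontr)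
      assume "\<not> p i0 \<le> q + l + 2"
      then show False
        using no_ones[of l] ones[of i] i0(2) L' \<open>p i < q\<close> Suc by (simp add: less_imp_le)
    qed
  qed
  have step: "Suc i \<le> k \<and> p (Suc i) \<le> p i + l + 2"
    if "i \<le> k" "q \<le> p i" "p i + 2 * l + 3 \<le> q + L" for i
  proof
    show "Suc i \<le> k" using that len L(2) v by (cases "i = k") (auto simp: l_def)
    show "p (Suc i) \<le> p i + l + 2"
    proof (rule ccontr)
      assume "\<not> p (Suc i) \<le> p i + l + 2"
      then show False
        using no_ones[of "p i - q + l"] ones[of i] that \<open>Suc i \<le> k\<close> by force
    qed
  qed
  have run: "i0 + m \<le> k \<and> q \<le> p (i0 + m) \<and> p (i0 + m) \<le> q + (m + 1) * (l + 2)" if "m \<le> 6" for m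
    using that
  proof (induction m)
    case 0
    then show ?case using i0 start by simp
  next
    case (Suc m)
    then have IH: "i0 + m \<le> k" "q \<le> p (i0 + m)" "p (i0 + m) \<le> q + (m + 1) * (l + 2)" by auto
    have "(m + 1) * (l + 2) \<le> 6 * (l + 2)" by (rule mult_le_mono1) (use Suc.prems in simp)
    then have "p (i0 + m) + 2 * l + 3 \<le> q + L" using IH(3) L' by simp
    from step[OF IH(1,2) this] gap[of "i0 + m"] IH(2,3) show ?case by auto
  qed
  define t where "t m = p (i0 + m) - q" for m
  have t_bound: "t m \<le> 7 * (l + 2)" if "m \<le> 6" for m
  proof -
    have "(m + 1) * (l + 2) \<le> 7 * (l + 2)" by (rule mult_le_mono1) (use that in simp)
    then show ?thesis using run[OF that] unfolding t_def by linarith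
  qed
  have p_t: "p (i0 + m) = q + t m" if "m \<le> 6" for m using run[OF that] by (simp add: t_def)
  have t_copy: "morse (t m + j) = v ! j" if "m \<le> 6" "j < l" for m j
    using copy[of "i0 + m" j] window[of "t m + j"] run[OF that(1)] p_t[OF that(1)] t_bound[OF that(1)]
      that(2) L' by (simp add: add.assoc)
  have t_gap: "t m + l \<le> t (Suc m)" "t (Suc m) \<le> t m + l + 2" if "m < 6" for m
  proof -
    have m: "m \<le> 6" "Suc m \<le> 6" using that by auto
    have "i0 + m < k" using run[OF m(2)] by simp
    then show "t m + l \<le> t (Suc m)" using gap[of "i0 + m"] p_t[OF m(1)] p_t[OF m(2)] by simp
    have "p (i0 + m) + 2 * l + 3 \<le> q + L \<or> m = 6"
      using t_bound[OF m(1)] p_t[OF m(1)] L' by simp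
    then show "t (Suc m) \<le> t m + l + 2"
      using step[of "i0 + m"] run[OF m(1)] p_t[OF m(1)] p_t[OF m(2)] that by simp
  qed
  have t_ones: "morse u = 1" if "m < 6" "t m + l \<le> u" "u < t (Suc m)" for m u
    using ones[of "i0 + m" "q + u"] run[of "Suc m"] p_t[of m] p_t[of "Suc m"] window[of u]
      t_bound[of "Suc m"] L' that by simp
  have t_mod: "t m mod 4 = t 0 mod 4" if "m \<le> 6" for m
    using t_copy[OF that] t_copy[of 0] v
    by (intro morse_recognizable_mod_4) (simp add: l_def)
  define n where "n = t 1 - t 0"
  have n: "t 1 = t 0 + n" "l \<le> n" "n \<le> l + 2" using t_gap[of 0] by (auto simp: n_def)
  \<comment> \<open>Both distances are multiples of 4 between \<open>l\<close> and
    \<open>l + 2\<close>, where at most one exists.\<close>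
  have t_Suc: "t (Suc m) = t m + n" if "m < 6" for m
  proof -
    have "4 dvd t (Suc m) - t m" "4 dvd t 1 - t 0"
      using t_mod[of m] t_mod[of "Suc m"] t_mod[of 1] t_gap(1)[OF that] t_gap(1)[of 0] that
      by (simp_all flip: mod_eq_dvd_iff_nat)
    then obtain c d where "t (Suc m) - t m = 4 * c" "n = 4 * d"
      unfolding n_def by (elim dvdE)
    moreover from this have "c = d" using t_gap[OF that] n(2,3) by linarith
    ultimately show ?thesis using t_gap(1)[OF that] by simp
  qed
  have t_eq: "t m = t 0 + m * n" if "m \<le> 6" for m
    using that by (induction m) (auto simp: t_Suc)
  show False
  proof (rule morse_no_fifth_power[of n "t 0"])
    show "0 < n" using n(2) v by (simp add: l_def)
    fix u assume u: "t 0 \<le> u" "u < t 0 + 5 * n"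
    \<comment> \<open>\<open>r < l\<close> places \<open>u\<close> inside a copy of
      \<open>v\<close>; otherwise \<open>u\<close> and \<open>u + n\<close> both lie in spacers. As
      m is at most 4, the last copy used is number 6.\<close>
    define m r where "m = (u - t 0) div n" and "r = (u - t 0) mod n"
    have "m < 5" unfolding m_def using u by (simp add: less_mult_imp_div_less)
    have "r < n" unfolding r_def using \<open>0 < n\<close> by simp
    have "m * n + r = u - t 0" unfolding m_def r_def by simp
    then have u_eq: "u = t m + r" using u(1) t_eq[of m] \<open>m < 5\<close> by simp
    then have un_eq: "u + n = t (Suc m) + r" using t_Suc[of m] \<open>m < 5\<close> by simp
    show "morse u = morse (u + n)"
    proof (cases "r < l")
      case True
      then show ?thesis unfolding un_eq unfolding u_eq using t_copy \<open>m < 5\<close> by simp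
    next
      case False
      then show ?thesis
        using t_ones[of m u] t_ones[of "Suc m" "u + n"] t_Suc[of m] t_Suc[of "Suc m"] \<open>m < 5\<close> \<open>r < n\<close>
        by (simp add: u_eq)
    qed
  qed
qed

text \<open>Equal systems share only the factors of their points, so a Morse prefix reaches
  \<open>W\<close> through the reflected two-sided point.\<close>

lemma system_of_morse_not_rank_one:
  assumes rank: "rank_one_construction W" and X: "system_of morse = system_of W"
  shows False
proof -
  obtain N and v :: "nat \<Rightarrow> nat \<Rightarrow> word" where N: "\<forall>i. 1 \<le> N i \<and> N i \<le> (1::nat)"
    and zero: "\<forall>i. \<forall>j\<in>{1..N i}. v i j \<in> zero_words"
    and built: "\<forall>i. built_from_starting (v i ` {1..N i}) (v i 1) (v (i + 1) 1)"
    and init: "\<forall>i. initial_segment (v i (1::nat)) W"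
    using rank unfolding rank_one_construction_def at_most_spacer_rank_def
    by (elim exE conjE) (rule that; assumption)
  have N1: "N i = 1" for i using N by (simp add: le_antisym)
  define V where "V i = v i 1" for i
  have V_zero: "V i \<in> zero_words" for i using zero by (simp add: V_def N1)
  have V_Suc: "\<exists>k u a. 1 \<le> k \<and> (\<forall>j\<in>{1..k + 1}. u j = V i) \<and> V (Suc i) = spaced_concat k u a" for i
    using built[rule_format, of i] by (auto simp: built_from_starting_def N1 V_def)
  have V_powers: "V j \<in> spaced_powers (V i)" if "i \<le> j" for i j
    using that
  proof (induction j rule: dec_induct)
    case base
    show ?case by (rule spaced_powers.single)
  next
    case (step j)
    then show ?case using V_Suc[of j] spaced_concat_in_spaced_powers by metis
  qed
  \<comment> \<open>Since k is at least 1, each level contains two nonempty copies of the previous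
    one and is strictly longer.\<close>
  have V_length: "i < length (V i)" for i
  proof (induction i)
    case 0
    then show ?case using V_zero[of 0] by (simp add: zero_words_def)
  next
    case (Suc i)
    obtain k u a where *: "1 \<le> k" "\<forall>j\<in>{1..k + 1}. u j = V i" "V (Suc i) = spaced_concat k u a"
      using V_Suc by blast
    obtain k' where k': "k = Suc k'" using *(1) by (cases k) auto
    have "spaced_concat k' u a \<noteq> []"
      using *(2) V_zero[of i] by (auto simp: spaced_concat_def zero_words_def k')
    then have "0 < length (spaced_concat k' u a)" by simp
    moreover have "u (k' + 2) = V i" using *(2) by (simp add: k')
    ultimately show ?case using Suc unfolding *(3) k' spaced_concat_Suc
      by (simp del: length_greater_0_conv)
  qed
  \<comment> \<open>Level 10 is chosen because \<open>V 10\<close> has more than ten letters, enough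
    for recognizability modulo 4.\<close>
  define L where "L = 10 * (length (V 10) + 2)"
  define u where "u = map morse [0..<L]"
  have "subword_of_biinf u (\<lambda>i. if 0 \<le> i then morse (nat i) else morse (nat (- 1 - i)))"
    unfolding subword_of_biinf_def u_def by (intro exI[of _ 0]) simp
  then have "subword_of_inf u W"
    using morse_reflected_in_system[unfolded X] by (simp add: system_of_def)
  then obtain q where q: "\<And>j. j < L \<Longrightarrow> morse j = W (q + j)"
    by (auto simp: subword_of_inf_def u_def)
  \<comment> \<open>This prefix of \<open>W\<close> is long enough to cover the window at
    \<open>q\<close>, and its level is at least 10.\<close>
  let ?w = "V (q + L + 10)"
  have "q + L + 10 < length ?w" by (rule V_length)
  then show False
    using V_length[of 10] V_powers[of 10 "q + L + 10"] init[rule_format, of "q + L + 10"] q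
    by (intro morse_window_not_spaced_power[of "V 10" ?w L q])
      (auto simp: L_def initial_segment_def V_def)
qed

theorem corollary6p8:
  shows "spacer_rank_two_system (system_of morse)"
  unfolding spacer_rank_two_system_def
proof (intro conjI)
  show no_rank_one: "\<not> (\<exists>W'. rank_one_construction W' \<and> system_of morse = system_of W')"
    using system_of_morse_not_rank_one by blast
  show "\<exists>W. spacer_rank_two_construction W \<and> system_of morse = system_of W"
    \<comment> \<open>The witness is \<open>morse\<close>; \<open>no_rank_one\<close> applied to it
      also excludes rank one for the word itself.\<close>
    using no_rank_one at_most_spacer_rank_2_morse
    unfolding spacer_rank_two_construction_def rank_one_construction_def by blast
qed (rule subshift_system_of)

end
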